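(* Let $1\le k\le n$, let $\gamma\equiv\gamma^{(2n)}$ be a complex sequence with moment matrix $M^d(n)\equiv M^d(n)(\gamma)$, and let $p(z,\bar z)\equiv\sum_{r,s\in\mathbb{Z}_+^d,\;|r|+|s|\le\delta}a_{rs}\bar z^rz^s\in\mathbb{C}^d[z,\bar z]$, where $\delta:=\deg p=2k$ or $2k-1$. Let $\eta:=\binom{n-k+2d}{2d}$. For each $r,s\in\mathbb{Z}_+^d$ with $|r|+|s|\le\delta$, let $i\equiv i(r,s,k)$, $j\equiv j(r,s,k)$, $t\equiv t(r,s,k)$, $u\equiv u(r,s,k)$ in $\mathbb{Z}_+^d$ be chosen such that $i+t=r$, $j+u=s$, $|i|+|j|\le k$ and $|t|+|u|\le k$ (such tuples always exist). Then the localizing matrix satisfies $$M_p^d(n)=\sum_{r,s\in\mathbb{Z}_+^d,\;|r|+|s|\le\delta}a_{rs}\;{}_{[\bar Z^uZ^t;1,\eta]}M^d(n)_{[\bar Z^iZ^j;1,\eta]}.$$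
   Context: $\mathbb{C}_l^d[z,\bar z]$ is the space of complex polynomials of total degree $\le l$ in $z=(z_1,\dots,z_d)$, $\bar z=(\bar z_1,\dots,\bar z_d)$, with basis the monomials $\bar z^iz^j$, $|i|+|j|\le l$ ($i,j\in\mathbb{Z}_+^d$, $|i|=i_1+\dots+i_d$), ordered by degree and lexicographically within each degree with respect to $z_1,\dots,z_d,\bar z_1,\dots,\bar z_d$ (for $d=l=2$: $1,z_1,z_2,\bar z_1,\bar z_2,z_1^2,z_1z_2,\bar z_1z_1,\bar z_2z_1,z_2^2,\bar z_1z_2,\bar z_2z_2,\bar z_1^2,\bar z_1\bar z_2,\bar z_2^2$); $\hat f$ is the coefficient vector of $f$ in this basis. For $\gamma=\{\gamma_{ij}\}_{|i|+|j|\le 2n}$, the Riesz functional is $\Lambda_\gamma(\sum b_{rs}\bar z^rz^s)=\sum b_{rs}\gamma_{rs}$ on $\mathbb{C}_{2n}^d[z,\bar z]$. The moment matrix $M^d(n)(\gamma)$ has rows and columns indexed by the monomials of degree $\le n$ (the one for $\bar z^iz^j$ being denoted $\bar Z^iZ^j$) and is determined by $\langle M^d(n)(\gamma)\hat f,\hat g\rangle=\Lambda_\gamma(f\bar g)$, $f,g\in\mathbb{C}_n^d[z,\bar z]$. Localizing matrix: $M_p^d(n)$ is the $\eta\times\eta$ matrix (rows and columns indexed by monomials of degree $\le n-k$) determined by $\langle M_p^d(n)\hat f,\hat g\rangle=\Lambda_\gamma(pf\bar g)$ for $f,g\in\mathbb{C}_{n-k}^d[z,\bar z]$. ${}_{[\bar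 Z^uZ^t;1,\eta]}M^d(n)_{[\bar Z^iZ^j;1,\eta]}$ denotes the compression of $M^d(n)$ to the first $\eta$ rows that are indexed by multiples of $\bar Z^uZ^t$ and to the first $\eta$ columns that are indexed by multiples of $\bar Z^iZ^j$ (in the ordering above; these are the rows $\bar Z^{u+a}Z^{t+b}$ and columns $\bar Z^{i+a}Z^{j+b}$ with $|a|+|b|\le n-k$, in the order of the monomials $\bar z^az^b$). *)

theory Defs
  imports
    "HOL-Library.Poly_Mapping"
    "HOL-Library.Product_Plus"
    "HOL-Library.Cardinality"
    "Jordan_Normal_Form.DL_Submatrix"
begin

text \<open>
  The dimension d is the cardinality of the finite linearly ordered index type \<open>'d\<close>, whose
  elements are the positions 1, ..., d in increasing order.  A pair \<open>(i, j)\<close> of multi-indices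
  stands for the monomial \<open>zbar^i z^j\<close>, in this order, so that the product of monomials is the
  sum of pairs, and polynomials in \<open>z\<close> and \<open>zbar\<close> are finitely supported coefficient functions on
  pairs, with the convolution product.
\<close>

type_synonym 'd multiindex = "'d \<Rightarrow>\<^sub>0 nat"
type_synonym 'd mono = "'d multiindex \<times> 'd multiindex"
type_synonym 'd cpoly = "'d mono \<Rightarrow>\<^sub>0 complex"

definition msize :: "'d::finite multiindex \<Rightarrow> nat" where
  "msize i = (\<Sum>x\<in>UNIV. Poly_Mapping.lookup i x)"

definition mdeg :: "'d::finite mono \<Rightarrow> nat" where
  "mdeg m = msize (fst m) + msize (snd m)"

definition pdeg :: "'d::finite cpoly \<Rightarrow> nat" where
  "pdeg p = Max (insert 0 (mdeg ` Poly_Mapping.keys p))"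

definition cpolys :: "nat \<Rightarrow> 'd::finite cpoly set" where
  "cpolys l = {f. \<forall>m\<in>Poly_Mapping.keys f. mdeg m \<le> l}"

definition cnj_poly :: "'d cpoly \<Rightarrow> 'd cpoly" where
  "cnj_poly f = (\<Sum>(r, s)\<in>Poly_Mapping.keys f. Poly_Mapping.single (s, r) (cnj (Poly_Mapping.lookup f (r, s))))"

text \<open>
  The exponents are listed with respect to \<open>z_1, ..., z_d, zbar_1, ..., zbar_d\<close>.  Within a degree,
  the monomial with the lexicographically larger list comes first:
  \<open>z_1^2\<close> before \<open>z_1 z_2\<close> before \<open>zbar_1 z_1\<close>.
\<close>

definition exponents :: "'d::{finite,linorder} mono \<Rightarrow> nat list" where
  "exponents m = (let xs = sorted_list_of_set (UNIV :: 'd set)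
     in map (Poly_Mapping.lookup (snd m)) xs @ map (Poly_Mapping.lookup (fst m)) xs)"

definition mono_less :: "'d::{finite,linorder} mono \<Rightarrow> 'd mono \<Rightarrow> bool" where
  "mono_less m m' \<longleftrightarrow> mdeg m < mdeg m' \<or>
     mdeg m = mdeg m' \<and> (exponents m', exponents m) \<in> lex less_than"

definition mono_list :: "nat \<Rightarrow> 'd::{finite,linorder} mono list" where
  "mono_list l = (THE ms. set ms = {m. mdeg m \<le> l} \<and> sorted_wrt mono_less ms)"

definition coeff_vec :: "nat \<Rightarrow> 'd::{finite,linorder} cpoly \<Rightarrow> complex vec" where
  "coeff_vec l f = vec (length (mono_list l :: 'd mono list)) (\<lambda>x. Poly_Mapping.lookup f (mono_list l ! x))"

text \<open>
  A sequence \<open>\<gamma>\<close> truncated at degree 2n is given by a total function, of which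
  \<open>moment_matrix n \<gamma>\<close> uses only the values at the monomials of degree at most 2n.
\<close>

definition riesz :: "('d mono \<Rightarrow> complex) \<Rightarrow> 'd cpoly \<Rightarrow> complex" where
  "riesz \<gamma> f = (\<Sum>m\<in>Poly_Mapping.keys f. Poly_Mapping.lookup f m * \<gamma> m)"

definition moment_matrix ::
    "nat \<Rightarrow> ('d::{finite,linorder} mono \<Rightarrow> complex) \<Rightarrow> complex mat" where
  "moment_matrix n \<gamma> =
     (THE M. M \<in> carrier_mat (length (mono_list n :: 'd mono list)) (length (mono_list n :: 'd mono list)) \<and>
        (\<forall>f\<in>cpolys n. \<forall>g\<in>cpolys n.
           (M *\<^sub>v coeff_vec n f) \<bullet>c coeff_vec n g = riesz \<gamma> (f * cnj_poly g)))"

definition localizing_matrix ::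
    "nat \<Rightarrow> nat \<Rightarrow> ('d::{finite,linorder} mono \<Rightarrow> complex) \<Rightarrow> 'd cpoly \<Rightarrow> complex mat" where
  "localizing_matrix n k \<gamma> p =
     (THE M. M \<in> carrier_mat (length (mono_list (n - k) :: 'd mono list))
                             (length (mono_list (n - k) :: 'd mono list)) \<and>
        (\<forall>f\<in>cpolys (n - k). \<forall>g\<in>cpolys (n - k).
           (M *\<^sub>v coeff_vec (n - k) f) \<bullet>c coeff_vec (n - k) g = riesz \<gamma> (p * f * cnj_poly g)))"

text \<open>Positions (from 0) of the multiples of a monomial among those of degree at most n.\<close>

definition multiple_positions :: "nat \<Rightarrow> 'd::{finite,linorder} mono \<Rightarrow> nat list" where
  "multiple_positions n m =
     filter (\<lambda>x. \<exists>c. mono_list n ! x = m + c) [0..<length (mono_list n :: 'd mono list)]"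

definition compression ::
    "nat \<Rightarrow> nat \<Rightarrow> 'd::{finite,linorder} mono \<Rightarrow> 'd mono \<Rightarrow> complex mat \<Rightarrow> complex mat" where
  "compression n \<eta> m m' M =
     submatrix M (set (take \<eta> (multiple_positions n m))) (set (take \<eta> (multiple_positions n m')))"

definition index_split ::
    "nat \<Rightarrow> 'd::finite multiindex \<Rightarrow> 'd multiindex \<Rightarrow>
     'd multiindex \<Rightarrow> 'd multiindex \<Rightarrow> 'd multiindex \<Rightarrow> 'd multiindex \<Rightarrow> bool" where
  "index_split k r s i j t u \<longleftrightarrow>
     i + t = r \<and> j + u = s \<and> msize i + msize j \<le> k \<and> msize t + msize u \<le> k"

end

theory Submission
  imports Defs
begin

text \<open>
  The sesquilinear form of a linear functional \<open>\<Phi>\<close> on polynomials has the entry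
  \<open>\<Phi> (zbar^a' z^b' z^a zbar^b)\<close> at the row \<open>zbar^a z^b\<close> and the column \<open>zbar^a' z^b'\<close>.
  Multiplication by a monomial of degree at most \<open>k\<close> preserves the ordering, so the first
  \<open>\<eta>\<close> of its multiples are the products with the \<open>\<eta>\<close> monomials of degree at most
  \<open>n - k\<close>.  Conjugation of the row index turns the factor \<open>zbar^u z^t\<close> into
  \<open>zbar^t z^u\<close>, hence the compression for \<open>(r, s)\<close> has the entries
  \<open>\<Lambda> (zbar^r z^s f gbar)\<close> for monomials \<open>f\<close>, \<open>g\<close>, and linearity in \<open>p\<close> concludes.
\<close>

section \<open>Monomial expansions and the Riesz functional\<close>

lemma poly_mapping_eq_sum_single:
  fixes f :: "'a \<Rightarrow>\<^sub>0 'b::comm_monoid_add"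
  assumes "finite S" "Poly_Mapping.keys f \<subseteq> S"
  shows "f = (\<Sum>m\<in>S. Poly_Mapping.single m (Poly_Mapping.lookup f m))"
proof (rule poly_mapping_eqI)
  fix k
  have "Poly_Mapping.lookup (\<Sum>m\<in>S. Poly_Mapping.single m (Poly_Mapping.lookup f m)) k
      = (\<Sum>m\<in>S. if m = k then Poly_Mapping.lookup f k else 0)"
    unfolding lookup_sum by (intro sum.cong refl) (auto simp: lookup_single when_def)
  also have "\<dots> = Poly_Mapping.lookup f k"
    using assms by (auto simp: in_keys_iff subset_iff)
  finally show "Poly_Mapping.lookup f k =
      Poly_Mapping.lookup (\<Sum>m\<in>S. Poly_Mapping.single m (Poly_Mapping.lookup f m)) k" ..
qed

text \<open>Conjugation exchanges \<open>z\<close> and \<open>zbar\<close>, hence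
  \<open>prod.swap\<close>. The set \<open>S\<close> may exceed the support, so that all polynomials
  of bounded degree expand over one common index set.\<close>

lemma cnj_poly_eq_sum_single:
  assumes "finite S" "Poly_Mapping.keys g \<subseteq> S"
  shows "cnj_poly g = (\<Sum>m\<in>S. Poly_Mapping.single (prod.swap m) (cnj (Poly_Mapping.lookup g m)))"
proof -
  have "(\<Sum>m\<in>S. Poly_Mapping.single (prod.swap m) (cnj (Poly_Mapping.lookup g m)))
    = (\<Sum>m\<in>Poly_Mapping.keys g. Poly_Mapping.single (prod.swap m) (cnj (Poly_Mapping.lookup g m)))"
    using assms by (intro sum.mono_neutral_right) (auto simp: in_keys_iff)
  then show ?thesis by (simp add: cnj_poly_def split_def prod.swap_def)
qed

lemma riesz_add: "riesz \<gamma> (f + g) = riesz \<gamma> f + riesz \<gamma> g"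
  unfolding riesz_def by (rule setsum_keys_plus_distrib) (auto simp: algebra_simps)

lemma riesz_single: "riesz \<gamma> (Poly_Mapping.single m c) = c * \<gamma> m"
  by (cases "c = 0") (auto simp: riesz_def)

lemma riesz_sum: "riesz \<gamma> (\<Sum>x\<in>A. f x) = (\<Sum>x\<in>A. riesz \<gamma> (f x))"
  by (rule additive.sum) (simp add: additive_def riesz_add)

section \<open>Degrees and factorizations of monomials\<close>

lemma msize_add: "msize (i + j) = msize i + msize j"
  by (simp add: msize_def lookup_add sum.distrib)

lemma mdeg_add: "mdeg (m + m') = mdeg m + mdeg m'"
  by (simp add: mdeg_def msize_add)

lemma msize_single: "msize (Poly_Mapping.single x c) = c"
  by (simp add: msize_def lookup_single when_def)

lemma msize_zero: "msize 0 = 0"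
  by (simp add: msize_def)

lemma msize_pos_split:
  assumes "msize i > 0"
  obtains e i' where "i = e + i'" "msize e = 1"
proof -
  have "(\<Sum>x\<in>UNIV. Poly_Mapping.lookup i x) \<noteq> 0" using assms unfolding msize_def by linarith
  then obtain x where "Poly_Mapping.lookup i x \<noteq> 0" by (meson sum.neutral)
  \<comment> \<open>The truncated subtraction is exact because the exponent at \<open>x\<close> is
    at least 1.\<close>
  then have "i = Poly_Mapping.single x 1 + (i - Poly_Mapping.single x 1)"
    by (intro poly_mapping_eqI) (auto simp: lookup_add lookup_minus lookup_single when_def)
  then show ?thesis using that msize_single by metis
qed

lemma mdeg_pos_split:
  assumes "mdeg m > 0"
  obtains e m' where "m = e + m'" "mdeg e = 1"
proof (cases "msize (fst m) > 0")
  case True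
  then obtain e i' where "fst m = e + i'" "msize e = 1" by (rule msize_pos_split)
  then show ?thesis
    using that[of "(e, 0)" "(i', snd m)"] by (auto simp: prod_eq_iff mdeg_def msize_zero)
next
  case False
  then have "msize (snd m) > 0" using assms by (auto simp: mdeg_def)
  then obtain e i' where "snd m = e + i'" "msize e = 1" by (rule msize_pos_split)
  then show ?thesis
    using that[of "(0, e)" "(fst m, i')"] by (auto simp: prod_eq_iff mdeg_def msize_zero)
qed

text \<open>Single variables move one at a time from the cofactor to the divisor, so every degree up
  to that of \<open>m\<close> is attained by a divisor.\<close>

lemma mdeg_split:
  assumes "c \<le> mdeg m"
  shows "\<exists>m1 m2. m = m1 + m2 \<and> mdeg m1 = c"
  using assms
proof (induction c)
  case 0
  show ?case by (rule exI[of _ 0], rule exI[of _ m]) (simp add: mdeg_def msize_zero)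
next
  case (Suc c)
  then obtain m1 m2 where m: "m = m1 + m2" "mdeg m1 = c" by auto
  with Suc.prems have "mdeg m2 > 0" by (simp add: mdeg_add)
  then obtain e m' where "m2 = e + m'" "mdeg e = 1" by (rule mdeg_pos_split)
  with m have "m = (m1 + e) + m' \<and> mdeg (m1 + e) = Suc c" by (simp add: mdeg_add add.assoc)
  then show ?case by blast
qed

text \<open>A divisor \<open>(i, j)\<close> of degree \<open>k\<close>, or of full degree if that is
  smaller, is split off; the cofactor \<open>(t, u)\<close> then has degree at most
  \<open>2 * k - k\<close>, or 0.\<close>

lemma index_split_exists:
  assumes "msize r + msize s \<le> 2 * k"
  shows "\<exists>i j t u. index_split k r s i j t u"
proof -
  have *: "mdeg (r, s) \<le> 2 * k" using assms by (simp add: mdeg_def)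
  obtain m1 m2 where "(r, s) = m1 + m2" "mdeg m1 = min k (mdeg (r, s))"
    using mdeg_split[of "min k (mdeg (r, s))" "(r, s)"] by auto
  moreover from this have "mdeg m2 \<le> k" using * by (simp add: mdeg_add)
  ultimately have "index_split k r s (fst m1) (snd m1) (fst m2) (snd m2)"
    unfolding index_split_def mdeg_def by (auto simp: prod_eq_iff)
  then show ?thesis by blast
qed

section \<open>Exponent lists and the number of monomials\<close>

lemma length_exponents: "length (exponents (m :: 'd::{finite,linorder} mono)) = 2 * CARD('d)"
  by (simp add: exponents_def Let_def)

lemma sum_list_exponents: "sum_list (exponents m) = mdeg m"
  by (simp add: exponents_def Let_def mdeg_def msize_def sum_list_distinct_conv_sum_set)

lemma exponents_inject: "exponents m = exponents m' \<longleftrightarrow> m = m'"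
  by (auto simp: exponents_def Let_def prod_eq_iff poly_mapping_eq_iff fun_eq_iff)

lemma exponents_add: "exponents (m + m') = map2 (+) (exponents m) (exponents m')"
  by (simp add: exponents_def Let_def zip_append zip_map_map zip_same_conv_map lookup_add)

lemma exists_lookup_list:
  assumes "length ys = CARD('d)"
  obtains i :: "'d::{finite,linorder} multiindex"
  where "map (Poly_Mapping.lookup i) (sorted_list_of_set UNIV) = ys"
proof
  let ?xs = "sorted_list_of_set (UNIV :: 'd set)"
  \<comment> \<open>Every variable occurs in \<open>?xs\<close>, so \<open>the\<close> is never
    applied to \<open>None\<close>; finiteness of the index type makes the support finite.\<close>
  show "map (Poly_Mapping.lookup (Abs_poly_mapping (\<lambda>x. the (map_of (zip ?xs ys) x)))) ?xs = ys"
    using assms by (intro nth_equalityI) (auto simp: map_of_zip_nth)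
qed

lemma exponents_surj:
  assumes "length es = 2 * CARD('d)"
  obtains m :: "'d::{finite,linorder} mono" where "exponents m = es"
proof -
  \<comment> \<open>The first half of the list holds the exponents of \<open>z\<close>, which form
    the second component of the pair.\<close>
  obtain j :: "'d multiindex"
    where j: "map (Poly_Mapping.lookup j) (sorted_list_of_set UNIV) = take CARD('d) es"
    using exists_lookup_list[of "take CARD('d) es"] assms by auto
  obtain i :: "'d multiindex"
    where i: "map (Poly_Mapping.lookup i) (sorted_list_of_set UNIV) = drop CARD('d) es"
    using exists_lookup_list[of "drop CARD('d) es"] assms by auto
  have "exponents (i, j) = es" using i j by (simp add: exponents_def)
  then show ?thesis using that by blast
qed

text \<open>Prepending the slack \<open>l - mdeg m\<close> makes the exponent lists have sum exactly \<open>l\<close>.\<close>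

lemma
  fixes l :: nat
  defines "S \<equiv> {m :: 'd::{finite,linorder} mono. mdeg m \<le> l}"
  shows finite_mdeg_le: "finite S"
    and card_mdeg_le: "card S = (l + 2 * CARD('d)) choose (2 * CARD('d))"
proof -
  define h where "h m = (l - mdeg m) # exponents m" for m :: "'d mono"
  let ?T = "{es :: nat list. length es = Suc (2 * CARD('d)) \<and> sum_list es = l}"
  have inj: "inj_on h S"
    by (auto simp: inj_on_def h_def exponents_inject)
  have "?T \<subseteq> h ` S"
  proof
    fix es assume es: "es \<in> ?T"
    then obtain e es' where e: "es = e # es'" by (cases es) auto
    with es obtain m :: "'d mono" where m: "exponents m = es'"
      using exponents_surj[of es'] by auto
    then have "e + mdeg m = l" using es e sum_list_exponents[of m] by simp
    then have "m \<in> S" "h m = es" using e m by (auto simp: S_def h_def)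
    then show "es \<in> h ` S" by blast
  qed
  moreover have "h ` S \<subseteq> ?T"
    by (auto simp: S_def h_def length_exponents sum_list_exponents)
  ultimately have image: "h ` S = ?T" by blast
  \<comment> \<open>Stars and bars counts the lists as \<open>l + 2 * CARD('d)\<close> choose
    \<open>l\<close>; symmetry of the binomial gives the stated form.\<close>
  have card: "card ?T = (l + 2 * CARD('d)) choose (2 * CARD('d))"
    using card_length_sum_list[of "Suc (2 * CARD('d))" l]
      binomial_symmetric[of l "l + 2 * CARD('d)"] by simp
  \<comment> \<open>An infinite set has \<open>card\<close> equal to 0, so the positive count
    already yields finiteness.\<close>
  then have "card ?T \<noteq> 0" by simp
  then have "finite ?T" by (rule contrapos_np) simp
  then show "finite S" using image inj by (metis finite_imageD)
  show "card S = (l + 2 * CARD('d)) choose (2 * CARD('d))"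
    using card card_image[OF inj] image by simp
qed

section \<open>The monomial order and its enumeration\<close>

lemma lex_less_than_total:
  assumes "length xs = length ys"
  shows "(xs, ys) \<in> lex less_than \<or> xs = ys \<or> (ys, xs) \<in> lex less_than"
  using assms by (induction xs ys rule: list_induct2) auto

text \<open>Adding the same number to both entries at a position preserves and reflects equality and
  strict inequality, so the first difference stays in place with the same sign.\<close>

lemma lex_less_than_map2_add:
  fixes xs ys zs :: "nat list"
  assumes "length zs = length xs" "length xs = length ys"
  shows "(map2 (+) zs xs, map2 (+) zs ys) \<in> lex less_than \<longleftrightarrow> (xs, ys) \<in> lex less_than"
  using assms by (induction zs xs ys rule: list_induct3) auto

abbreviation mono_le :: "'d::{finite,linorder} mono \<Rightarrow> 'd mono \<Rightarrow> bool" where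
  "mono_le m m' \<equiv> mono_less m m' \<or> m = m'"

text \<open>Stated as a \<open>class.linorder\<close> predicate, this makes the facts on strictly
  sorted lists applicable to \<open>mono_less\<close> without a class instance.\<close>

lemma linorder_mono_less:
  "class.linorder mono_le (mono_less :: 'd::{finite,linorder} mono \<Rightarrow> _)"
proof
  have irrefl: "\<not> mono_less m m" for m :: "'d mono"
    using irrefl_lex[of less_than] by (auto simp: mono_less_def irrefl_def)
  have trans: "mono_less a b \<Longrightarrow> mono_less b c \<Longrightarrow> mono_less a c" for a b c :: "'d mono"
    unfolding mono_less_def using lex_transI[OF trans_less_than] by (auto dest: transD)
  fix x y z :: "'d mono"
  show "mono_less x y \<longleftrightarrow> mono_le x y \<and> \<not> mono_le y x"
    using irrefl trans by metis
  show "mono_le x y \<Longrightarrow> mono_le y z \<Longrightarrow> mono_le x z"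
    using trans by metis
  show "mono_le x y \<Longrightarrow> mono_le y x \<Longrightarrow> x = y"
    using irrefl trans by metis
  show "mono_le x y \<or> mono_le y x"
    using lex_less_than_total[of "exponents x" "exponents y"]
    by (auto simp: mono_less_def length_exponents exponents_inject)
qed simp

lemma mono_less_add_left: "mono_less (m + a) (m + b) \<longleftrightarrow> mono_less a b"
  by (simp add: mono_less_def mdeg_add exponents_add lex_less_than_map2_add length_exponents)

text \<open>A strictly sorted list is determined by its set of elements, which resolves the definite
  description in \<open>mono_list\<close>.\<close>

lemma mono_list_eqI:
  fixes ms :: "'d::{finite,linorder} mono list"
  assumes "set ms = {m. mdeg m \<le> l}" "sorted_wrt mono_less ms"
  shows "mono_list l = ms"
  unfolding mono_list_def
proof (rule the_equality)
  fix ms' :: "'d mono list"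
  assume "set ms' = {m. mdeg m \<le> l} \<and> sorted_wrt mono_less ms'"
  then show "ms' = ms"
    using assms linorder.strict_sorted_equal[OF linorder_mono_less, of ms ms'] by simp
qed (use assms in simp)

lemma
  shows set_mono_list: "set (mono_list l) = {m :: 'd::{finite,linorder} mono. mdeg m \<le> l}"
    and sorted_mono_list: "sorted_wrt mono_less (mono_list l :: 'd mono list)"
proof -
  obtain ms :: "'d mono list" where ms: "set ms = {m. mdeg m \<le> l}" "sorted_wrt mono_less ms"
    using linorder.finite_set_strict_sorted[OF linorder_mono_less finite_mdeg_le] by metis
  then have "mono_list l = ms" by (rule mono_list_eqI)
  with ms show "set (mono_list l) = {m :: 'd mono. mdeg m \<le> l}"
    and "sorted_wrt mono_less (mono_list l :: 'd mono list)" by auto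
qed

lemma distinct_mono_list: "distinct (mono_list l)"
  using sorted_mono_list linorder.strict_sorted_iff[OF linorder_mono_less] by blast

lemma length_mono_list:
  "length (mono_list l :: 'd::{finite,linorder} mono list) = (l + 2 * CARD('d)) choose (2 * CARD('d))"
proof -
  have "length (mono_list l :: 'd mono list) = card (set (mono_list l :: 'd mono list))"
    by (rule distinct_card[OF distinct_mono_list, symmetric])
  then show ?thesis by (simp add: set_mono_list card_mdeg_le)
qed

text \<open>The order compares degrees first, so the monomials of smaller degree form an initial
  segment.\<close>

lemma mono_list_take:
  assumes "l' \<le> l"
  shows "take (length (mono_list l' :: 'd::{finite,linorder} mono list)) (mono_list l) = (mono_list l' :: 'd mono list)"
proof -
  let ?rest = "filter (\<lambda>m. l' < mdeg m) (mono_list l) :: 'd mono list"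
  have "mono_list l = mono_list l' @ ?rest"
  proof (rule mono_list_eqI)
    show "set (mono_list l' @ ?rest) = {m. mdeg m \<le> l}"
      using assms by (auto simp: set_mono_list)
    show "sorted_wrt mono_less (mono_list l' @ ?rest)"
      by (auto simp: sorted_wrt_append sorted_mono_list sorted_wrt_filter set_mono_list mono_less_def)
  qed
  then show ?thesis by (metis append_eq_conv_conj)
qed

text \<open>Translation by \<open>m\<close> preserves the order, so both sides are strictly sorted;
  they have the same elements and therefore agree.\<close>

lemma filter_multiples_mono_list:
  fixes m :: "'d::{finite,linorder} mono"
  assumes "mdeg m \<le> n"
  shows "filter (\<lambda>x. \<exists>c. x = m + c) (mono_list n) = map ((+) m) (mono_list (n - mdeg m))"
proof (rule linorder.strict_sorted_equal[OF linorder_mono_less])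
  show "sorted_wrt mono_less (map ((+) m) (mono_list (n - mdeg m)))"
    by (simp add: sorted_wrt_map mono_less_add_left sorted_mono_list)
  show "sorted_wrt mono_less (filter (\<lambda>x. \<exists>c. x = m + c) (mono_list n))"
    by (simp add: sorted_wrt_filter sorted_mono_list)
  show "set (filter (\<lambda>x. \<exists>c. x = m + c) (mono_list n)) = set (map ((+) m) (mono_list (n - mdeg m)))"
    using assms by (auto simp: set_mono_list mdeg_add)
qed

section \<open>Positions of multiples and compressions\<close>

lemma map_nth_multiple_positions:
  fixes m :: "'d::{finite,linorder} mono"
  shows "map ((!) (mono_list n)) (multiple_positions n m) = filter (\<lambda>x. \<exists>c. x = m + c) (mono_list n)"
proof -
  let ?L = "mono_list n :: 'd mono list"
  have "filter (\<lambda>x. \<exists>c. x = m + c) (map ((!) ?L) [0..<length ?L])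
      = map ((!) ?L) (multiple_positions n m)"
    by (simp only: filter_map multiple_positions_def o_def)
  then show ?thesis by (simp only: map_nth)
qed

text \<open>The cofactors range over all monomials up to degree \<open>n - mdeg m\<close>, which is
  at least \<open>n - k\<close>; the truncation keeps those up to degree \<open>n - k\<close>, the
  same cofactors for every such \<open>m\<close>.\<close>

lemma first_multiples:
  fixes m :: "'d::{finite,linorder} mono"
  assumes "mdeg m \<le> k" "k \<le> n"
  shows "map ((!) (mono_list n)) (take (length (mono_list (n - k) :: 'd mono list)) (multiple_positions n m))
    = map ((+) m) (mono_list (n - k))"
  unfolding take_map[symmetric] map_nth_multiple_positions
  using assms by (simp add: filter_multiples_mono_list take_map mono_list_take del: split_paired_Ex)

text \<open>In an increasing list exactly the \<open>x\<close> earlier entries lie below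
  \<open>xs ! x\<close>, and \<open>pick\<close> selects an element by the number of smaller
  ones.\<close>

lemma pick_set_nth:
  assumes "sorted_wrt (<) xs" "x < length xs"
  shows "pick (set xs) x = xs ! x"
proof -
  have "{a \<in> set xs. a < xs ! x} = set (take x xs)"
  proof (intro equalityI subsetI)
    fix a assume "a \<in> {a \<in> set xs. a < xs ! x}"
    then obtain y where y: "y < length xs" "a = xs ! y" "xs ! y < xs ! x"
      by (auto simp: in_set_conv_nth)
    then have "y < x"
      using assms sorted_wrt_nth_less[OF assms(1), of x y] by (cases y x rule: linorder_cases) auto
    with y assms(2) show "a \<in> set (take x xs)" by (auto simp: in_set_conv_nth intro!: exI[of _ y])
  next
    fix a assume "a \<in> set (take x xs)"
    then show "a \<in> {a \<in> set xs. a < xs ! x}"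
      using assms in_set_takeD[of a x xs]
      by (auto simp: in_set_conv_nth[of a "take x xs"] intro: sorted_wrt_nth_less)
  qed
  moreover have "distinct xs" using assms(1) strict_sorted_iff by blast
  ultimately have "card {a \<in> set xs. a < xs ! x} = x"
    using assms(2) by (simp add: distinct_card distinct_take)
  then show ?thesis
    using pick_card_in_set[of "xs ! x" "set xs"] assms(2) by simp
qed

text \<open>The bounds ensure that no listed index is discarded, so the selection by sets in
  \<open>submatrix\<close> follows the order of the lists.\<close>

lemma submatrix_set_nth:
  assumes "sorted_wrt (<) xs" "sorted_wrt (<) ys"
    and "set xs \<subseteq> {..<dim_row A}" "set ys \<subseteq> {..<dim_col A}"
  shows "submatrix A (set xs) (set ys) = mat (length xs) (length ys) (\<lambda>(x, y). A $$ (xs ! x, ys ! y))"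
proof -
  have "{i. i < dim_row A \<and> i \<in> set xs} = set xs" "{j. j < dim_col A \<and> j \<in> set ys} = set ys"
    using assms(3,4) by auto
  moreover have "card (set xs) = length xs" "card (set ys) = length ys"
    using assms(1,2) by (simp_all add: strict_sorted_iff distinct_card)
  ultimately have "submatrix A (set xs) (set ys)
      = mat (length xs) (length ys) (\<lambda>(x, y). A $$ (pick (set xs) x, pick (set ys) y))"
    by (simp only: submatrix_def)
  also have "\<dots> = mat (length xs) (length ys) (\<lambda>(x, y). A $$ (xs ! x, ys ! y))"
    by (rule eq_matI) (simp_all add: pick_set_nth[OF assms(1)] pick_set_nth[OF assms(2)])
  finally show ?thesis .
qed

text \<open>With entries written as a function \<open>F\<close> of the row and column monomials,
  compressing amounts to shifting the labels by \<open>m\<close> and \<open>m'\<close>.\<close>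

lemma compression_mat:
  fixes m m' :: "'d::{finite,linorder} mono" and F :: "'d mono \<Rightarrow> 'd mono \<Rightarrow> complex"
  assumes "mdeg m \<le> k" "mdeg m' \<le> k" "k \<le> n"
    and \<eta>: "\<eta> = length (mono_list (n - k) :: 'd mono list)"
  shows "compression n \<eta> m m'
      (mat (length (mono_list n :: 'd mono list)) (length (mono_list n :: 'd mono list))
        (\<lambda>(x, y). F (mono_list n ! x) (mono_list n ! y)))
    = mat \<eta> \<eta> (\<lambda>(x, y). F (m + mono_list (n - k) ! x) (m' + mono_list (n - k) ! y))"
proof -
  let ?N = "length (mono_list n :: 'd mono list)"
  let ?M = "mat ?N ?N (\<lambda>(x, y). F (mono_list n ! x) (mono_list n ! y))"
  define pos where "pos a = take \<eta> (multiple_positions n a)" for a :: "'d mono"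
  have sorted: "sorted_wrt (<) (pos a)" for a
    by (simp add: pos_def multiple_positions_def sorted_wrt_take sorted_wrt_filter)
  have bounded: "set (pos a) \<subseteq> {..<?N}" for a
    by (auto simp: pos_def multiple_positions_def dest!: in_set_takeD)
  have nth: "map ((!) (mono_list n)) (pos a) = map ((+) a) (mono_list (n - k))"
    if "mdeg a \<le> k" for a
    using first_multiples[OF that \<open>k \<le> n\<close>] by (simp add: pos_def \<eta>)
  have len: "length (pos a) = \<eta>" if "mdeg a \<le> k" for a
    using arg_cong[OF nth[OF that], of length] \<eta> by simp
  have nth': "pos a ! x < ?N" "mono_list n ! (pos a ! x) = a + mono_list (n - k) ! x"
    if "mdeg a \<le> k" "x < \<eta>" for a x
  proof -
    show "pos a ! x < ?N" using bounded[of a] len[OF that(1)] that(2) nth_mem by blast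
    show "mono_list n ! (pos a ! x) = a + mono_list (n - k) ! x"
      using arg_cong[OF nth[OF that(1)], of "\<lambda>xs. xs ! x"] that(2) len[OF that(1)] \<eta> by simp
  qed
  have "compression n \<eta> m m' ?M = submatrix ?M (set (pos m)) (set (pos m'))"
    by (simp add: compression_def pos_def)
  also have "\<dots> = mat \<eta> \<eta> (\<lambda>(x, y). ?M $$ (pos m ! x, pos m' ! y))"
    using submatrix_set_nth[OF sorted sorted, of m ?M m'] bounded len assms by simp
  also have "\<dots> = mat \<eta> \<eta> (\<lambda>(x, y). F (m + mono_list (n - k) ! x) (m' + mono_list (n - k) ! y))"
    using nth' assms by (intro eq_matI) auto
  finally show ?thesis .
qed

section \<open>Matrices determined by sesquilinear forms\<close>

lemma sum_mono_list:
  fixes f :: "'d::{finite,linorder} mono \<Rightarrow> 'a::comm_monoid_add"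
  shows "(\<Sum>m | mdeg m \<le> l. f m)
    = (\<Sum>x<length (mono_list l :: 'd mono list). f (mono_list l ! x))"
  by (rule sum.reindex_bij_betw[OF bij_betw_nth[OF distinct_mono_list refl set_mono_list[symmetric]],
        symmetric])

text \<open>Unit vectors are fixed by conjugation, so the form evaluated at them reads off single
  entries. This gives uniqueness in the definite descriptions.\<close>

lemma mat_eq_of_sesquilinear:
  fixes M M' :: "complex mat"
  assumes M: "M \<in> carrier_mat N N" "M' \<in> carrier_mat N N"
    and eq: "\<And>x y. x < N \<Longrightarrow> y < N \<Longrightarrow>
      (M *\<^sub>v unit_vec N y) \<bullet>c unit_vec N x = (M' *\<^sub>v unit_vec N y) \<bullet>c unit_vec N x"
  shows "M = M'"
proof (rule eq_matI)
  have entry: "(A *\<^sub>v unit_vec N y) \<bullet>c unit_vec N x = A $$ (x, y)"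
    if "A \<in> carrier_mat N N" "x < N" "y < N" for A :: "complex mat" and x y
  proof -
    have "conjugate (unit_vec N x) = (unit_vec N x :: complex vec)"
      by (intro eq_vecI) (auto simp: unit_vec_def)
    then show ?thesis using that by simp
  qed
  fix x y assume "x < dim_row M'" "y < dim_col M'"
  then show "M $$ (x, y) = M' $$ (x, y)" using M eq[of x y] entry by auto
qed (use M in auto)

text \<open>
  Covers moment matrices (\<open>\<Phi> = riesz \<gamma>\<close>) and localizing matrices
  (\<open>\<Phi> h = riesz \<gamma> (p * h)\<close>) at once.
\<close>

lemma the_matrix_of_functional:
  fixes \<Phi> :: "'d::{finite,linorder} cpoly \<Rightarrow> complex"
  defines "N l \<equiv> length (mono_list l :: 'd mono list)"
  assumes add: "\<And>f g. \<Phi> (f + g) = \<Phi> f + \<Phi> g"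
    and single: "\<And>m c. \<Phi> (Poly_Mapping.single m c) = c * \<Phi> (Poly_Mapping.single m 1)"
  shows "(THE M. M \<in> carrier_mat (N l) (N l) \<and>
        (\<forall>f\<in>cpolys l. \<forall>g\<in>cpolys l.
           (M *\<^sub>v coeff_vec l f) \<bullet>c coeff_vec l g = \<Phi> (f * cnj_poly g)))
    = mat (N l) (N l)
        (\<lambda>(x, y). \<Phi> (Poly_Mapping.single (mono_list l ! y + prod.swap (mono_list l ! x)) 1))"
    (is "(THE M. ?P M) = ?M")
proof (rule the_equality)
  let ?L = "mono_list l :: 'd mono list"
  have \<Phi>_sum: "\<Phi> (\<Sum>x\<in>A. f x) = (\<Sum>x\<in>A. \<Phi> (f x))" for f :: "'d mono \<Rightarrow> _" and A
    by (rule additive.sum) (simp add: additive_def add)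
  show "?P ?M"
  proof (intro conjI ballI)
    fix f g :: "'d cpoly" assume "f \<in> cpolys l" "g \<in> cpolys l"
    then have keys: "Poly_Mapping.keys f \<subseteq> {m. mdeg m \<le> l}" "Poly_Mapping.keys g \<subseteq> {m. mdeg m \<le> l}"
      by (auto simp: cpolys_def)
    \<comment> \<open>The outer sum runs over the monomials of \<open>g\<close>, which index the
      rows, as in the scalar product of the matrix form.\<close>
    have "f * cnj_poly g = (\<Sum>m | mdeg m \<le> l. \<Sum>m' | mdeg m' \<le> l.
        Poly_Mapping.single (m' + prod.swap m)
          (Poly_Mapping.lookup f m' * cnj (Poly_Mapping.lookup g m)))"
      by (subst poly_mapping_eq_sum_single[OF finite_mdeg_le keys(1)],
          subst cnj_poly_eq_sum_single[OF finite_mdeg_le keys(2)],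
          subst sum.swap) (simp add: sum_product mult_single)
    then have "\<Phi> (f * cnj_poly g) = (\<Sum>m | mdeg m \<le> l. \<Sum>m' | mdeg m' \<le> l.
        Poly_Mapping.lookup f m' * cnj (Poly_Mapping.lookup g m) *
          \<Phi> (Poly_Mapping.single (m' + prod.swap m) 1))"
      by (simp only: \<Phi>_sum single[of _ "_ * _"])
    also have "\<dots> = (?M *\<^sub>v coeff_vec l f) \<bullet>c coeff_vec l g"
      unfolding sum_mono_list
      by (simp add: coeff_vec_def scalar_prod_def N_def sum_distrib_left sum_distrib_right
          lessThan_atLeast0 mult_ac)
    finally show "(?M *\<^sub>v coeff_vec l f) \<bullet>c coeff_vec l g = \<Phi> (f * cnj_poly g)" ..
  qed simp
  then have M: "?P ?M" .
  fix M assume "?P M"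
  \<comment> \<open>Monomials have unit coefficient vectors, so testing the defining identity on
    pairs of monomials determines every entry.\<close>
  have unit: "coeff_vec l (Poly_Mapping.single (?L ! y) 1) = unit_vec (N l) y" if "y < N l" for y
    using that
    by (intro eq_vecI)
      (auto simp: coeff_vec_def N_def lookup_single when_def
        nth_eq_iff_index_eq[OF distinct_mono_list])
  have mem: "Poly_Mapping.single (?L ! y) 1 \<in> cpolys l" if "y < N l" for y
    using that nth_mem[of y ?L] by (auto simp: cpolys_def N_def set_mono_list)
  show "M = ?M"
  proof (rule mat_eq_of_sesquilinear)
    fix x y assume xy: "x < N l" "y < N l"
    show "(M *\<^sub>v unit_vec (N l) y) \<bullet>c unit_vec (N l) x
        = (?M *\<^sub>v unit_vec (N l) y) \<bullet>c unit_vec (N l) x"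
      using conjunct2[OF \<open>?P M\<close>, rule_format, OF mem[OF xy(2)] mem[OF xy(1)]]
        conjunct2[OF M, rule_format, OF mem[OF xy(2)] mem[OF xy(1)]]
      by (simp only: unit[OF xy(1)] unit[OF xy(2)])
  qed (use conjunct1[OF \<open>?P M\<close>] in simp_all)
qed

section \<open>Entries of moment and localizing matrices\<close>

lemma moment_matrix_mat:
  fixes \<gamma> :: "'d::{finite,linorder} mono \<Rightarrow> complex"
  shows "moment_matrix n \<gamma> =
    mat (length (mono_list n :: 'd mono list)) (length (mono_list n :: 'd mono list))
      (\<lambda>(x, y). \<gamma> (mono_list n ! y + prod.swap (mono_list n ! x)))"
  unfolding moment_matrix_def
  by (subst the_matrix_of_functional) (simp_all add: riesz_add riesz_single)

text \<open>Expanding \<open>p\<close> exhibits the factor \<open>c\<close>, which is the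
  homogeneity required of the functional \<open>riesz \<gamma> (p * h)\<close> in
  \<open>h\<close>.\<close>

lemma riesz_mult_single:
  "riesz \<gamma> (p * Poly_Mapping.single m c)
    = c * (\<Sum>m'\<in>Poly_Mapping.keys p. Poly_Mapping.lookup p m' * \<gamma> (m' + m))"
proof -
  let ?q = "\<Sum>m'\<in>Poly_Mapping.keys p. Poly_Mapping.single m' (Poly_Mapping.lookup p m')"
  have "riesz \<gamma> (p * Poly_Mapping.single m c) = riesz \<gamma> (?q * Poly_Mapping.single m c)"
    using poly_mapping_eq_sum_single[OF finite_keys subset_refl, of p] by simp
  also have "\<dots> = (\<Sum>m'\<in>Poly_Mapping.keys p. Poly_Mapping.lookup p m' * c * \<gamma> (m' + m))"
    by (simp only: sum_distrib_right mult_single riesz_sum riesz_single)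
  finally show ?thesis by (simp add: sum_distrib_left mult_ac)
qed

lemma localizing_matrix_mat:
  fixes \<gamma> :: "'d::{finite,linorder} mono \<Rightarrow> complex"
  shows "localizing_matrix n k \<gamma> p =
    mat (length (mono_list (n - k) :: 'd mono list)) (length (mono_list (n - k) :: 'd mono list))
      (\<lambda>(x, y). \<Sum>m\<in>Poly_Mapping.keys p. Poly_Mapping.lookup p m *
        \<gamma> (m + (mono_list (n - k) ! y + prod.swap (mono_list (n - k) ! x))))"
  \<comment> \<open>Reassociation isolates \<open>f * cnj_poly g\<close> as the argument of the
    functional that multiplies by \<open>p\<close> first.\<close>
  unfolding localizing_matrix_def mult.assoc
  by (subst the_matrix_of_functional)
    (simp_all add: riesz_add distrib_left riesz_mult_single)

text \<open>The sum lives in the additive group of matrices of one fixed size, where zero and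
  addition are entrywise; induction on \<open>A\<close> turns it into ordinary sums.\<close>

lemma finsum_module_mat_mat:
  fixes F :: "'a \<Rightarrow> nat \<times> nat \<Rightarrow> 'b::comm_ring_1"
  assumes "finite A"
  shows "finsum (module_mat TYPE('b) nr nc) (\<lambda>a. mat nr nc (F a)) A
    = mat nr nc (\<lambda>xy. \<Sum>a\<in>A. F a xy)"
proof -
  interpret abelian_group "module_mat TYPE('b) nr nc" by (rule abelian_group_mat)
  show ?thesis
    using assms
  proof induction
    case empty
    show ?case by (auto simp: module_mat_simps)
  next
    case (insert a A)
    then show ?case
      by (subst finsum_insert) (auto simp: module_mat_simps)
  qed
qed

section \<open>The localizing matrix as a sum of compressions\<close>

lemma mdeg_le_pdeg:
  assumes "m \<in> Poly_Mapping.keys p"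
  shows "mdeg m \<le> pdeg p"
  using assms unfolding pdeg_def by (intro Max_ge) auto

theorem theorem3p2:
  fixes n k \<delta> \<eta> :: nat
    and \<gamma> :: "'d::{finite,linorder} mono \<Rightarrow> complex"
    and p :: "'d cpoly"
  assumes "1 \<le> k" and "k \<le> n"
    and "\<delta> = pdeg p" and "\<delta> = 2 * k \<or> \<delta> = 2 * k - 1"
    and "\<eta> = (n - k + 2 * CARD('d)) choose (2 * CARD('d))"
  shows "(\<forall>r s :: 'd multiindex. msize r + msize s \<le> \<delta> \<longrightarrow> (\<exists>i j t u. index_split k r s i j t u)) \<and>
    (\<forall>i j t u :: 'd multiindex \<Rightarrow> 'd multiindex \<Rightarrow> 'd multiindex.
       (\<forall>r s. msize r + msize s \<le> \<delta> \<longrightarrow> index_split k r s (i r s) (j r s) (t r s) (u r s)) \<longrightarrow>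
       localizing_matrix n k \<gamma> p =
         finsum (module_mat TYPE(complex) \<eta> \<eta>)
           (\<lambda>(r, s). Poly_Mapping.lookup p (r, s) \<cdot>\<^sub>m
              compression n \<eta> (u r s, t r s) (i r s, j r s) (moment_matrix n \<gamma>))
           {(r, s). msize r + msize s \<le> \<delta>})"
proof (intro conjI allI impI)
  fix r s :: "'d multiindex" assume "msize r + msize s \<le> \<delta>"
  then show "\<exists>i j t u. index_split k r s i j t u"
    using assms(4) by (intro index_split_exists) auto
next
  fix i j t u :: "'d multiindex \<Rightarrow> 'd multiindex \<Rightarrow> 'd multiindex"
  assume split: "\<forall>r s. msize r + msize s \<le> \<delta> \<longrightarrow> index_split k r s (i r s) (j r s) (t r s) (u r s)"
  let ?L = "mono_list (n - k) :: 'd mono list"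
  let ?S = "{(r, s). msize r + msize s \<le> \<delta>} :: 'd mono set"
  have S: "?S = {m. mdeg m \<le> \<delta>}" by (auto simp: mdeg_def)
  then have finite: "finite ?S" by (simp add: finite_mdeg_le)
  have keys: "Poly_Mapping.keys p \<subseteq> ?S"
    unfolding S using mdeg_le_pdeg assms(3) by auto
  have \<eta>: "\<eta> = length ?L" by (simp add: length_mono_list assms(5))
  \<comment> \<open>The contribution of the term of \<open>p\<close> at \<open>m\<close> to the
    localizing entry in row \<open>x\<close> and column \<open>y\<close>.\<close>
  let ?E = "\<lambda>m (x, y). Poly_Mapping.lookup p m * \<gamma> (m + (?L ! y + prod.swap (?L ! x)))"
  have summand: "Poly_Mapping.lookup p (r, s) \<cdot>\<^sub>m
      compression n \<eta> (u r s, t r s) (i r s, j r s) (moment_matrix n \<gamma>) = mat \<eta> \<eta> (?E (r, s))"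
    if "(r, s) \<in> ?S" for r s
  proof -
    have "index_split k r s (i r s) (j r s) (t r s) (u r s)" using that split by simp
    then have *: "i r s + t r s = r" "j r s + u r s = s"
      "mdeg (u r s, t r s) \<le> k" "mdeg (i r s, j r s) \<le> k"
      by (auto simp: index_split_def mdeg_def)
    \<comment> \<open>The swap turns the row factor \<open>(u, t)\<close> into
      \<open>(t, u)\<close>, which completes \<open>(i, j)\<close> to \<open>(r, s)\<close> whatever
      the cofactors \<open>a\<close> and \<open>b\<close> are.\<close>
    have "((i r s, j r s) + b) + prod.swap ((u r s, t r s) + a) = (r, s) + (b + prod.swap a)"
      for a b :: "'d mono"
    proof -
      have "((i r s, j r s) + b) + prod.swap ((u r s, t r s) + a)
          = (i r s + t r s, j r s + u r s) + (b + prod.swap a)"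
        by (simp add: prod_eq_iff add_ac)
      then show ?thesis by (simp add: *)
    qed
    then show ?thesis
      using compression_mat[OF *(3,4) assms(2) \<eta>, where F = "\<lambda>a b. \<gamma> (b + prod.swap a)"]
      by (auto simp: moment_matrix_mat intro!: eq_matI)
  qed
  interpret abelian_group "module_mat TYPE(complex) \<eta> \<eta>" by (rule abelian_group_mat)
  have "finsum (module_mat TYPE(complex) \<eta> \<eta>)
      (\<lambda>(r, s). Poly_Mapping.lookup p (r, s) \<cdot>\<^sub>m
        compression n \<eta> (u r s, t r s) (i r s, j r s) (moment_matrix n \<gamma>)) ?S
    = finsum (module_mat TYPE(complex) \<eta> \<eta>) (\<lambda>m. mat \<eta> \<eta> (?E m)) ?S"
    using summand by (intro finsum_cong') (auto simp: module_mat_simps)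
  also have "\<dots> = mat \<eta> \<eta> (\<lambda>xy. \<Sum>m\<in>?S. ?E m xy)"
    by (rule finsum_module_mat_mat[OF finite])
  \<comment> \<open>Coefficients of \<open>p\<close> vanish off its support, so the degree range may
    shrink to the keys.\<close>
  also have "\<dots> = mat \<eta> \<eta> (\<lambda>xy. \<Sum>m\<in>Poly_Mapping.keys p. ?E m xy)"
  proof -
    have "(\<Sum>m\<in>?S. ?E m xy) = (\<Sum>m\<in>Poly_Mapping.keys p. ?E m xy)" for xy
      using finite keys
      by (intro sum.mono_neutral_right) (auto simp: not_in_keys_iff_lookup_eq_zero)
    then show ?thesis by (simp only:)
  qed
  also have "\<dots> = localizing_matrix n k \<gamma> p"
    by (auto simp: localizing_matrix_mat \<eta> intro!: eq_matI)
  finally show "localizing_matrix n k \<gamma> p =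
      finsum (module_mat TYPE(complex) \<eta> \<eta>)
        (\<lambda>(r, s). Poly_Mapping.lookup p (r, s) \<cdot>\<^sub>m
          compression n \<eta> (u r s, t r s) (i r s, j r s) (moment_matrix n \<gamma>)) ?S" ..
qed

end
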